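(* Let $\mathbb{F}=\mathbb{R}$ or $\mathbb{F}=\mathbb{C}$. For an arbitrary $w\in\mathbb{F}$ with $|w|>1$, the linear operator \[ \hat{A}_wx:=\bigl(w^k(x_{k+1}-l(x))+x_1-l(x)\bigr)_{k\in\mathbb{N}} \] in the space $c(\mathbb{N})$ with domain \[ D(\hat{A}_w):=\left\{x=(x_k)_{k\in\mathbb{N}}\in c(\mathbb{N}) : \bigl(w^k(x_{k+1}-l(x))\bigr)_{k\in\mathbb{N}}\in c_0(\mathbb{N})\right\} \] is unbounded, closed, and chaotic, as well as its every power \[ \hat{A}_w^nx=\left(\left[\prod_{j=k}^{k+n-1}w^j\right](x_{k+n}-l(x))+\left[\prod_{j=0}^{n-1}w^j\right](x_n-l(x))\right)_{k\in\mathbb{N}},\quad n\in\mathbb{N}, \] with domain \[ D(\hat{A}_w^n)=\left\{x=(x_k)_{k\in\mathbb{N}}\in c(\mathbb{N}) : \left(\left[\prod_{j=k}^{k+n-1}w^j\right](x_{k+n}-l(x))\right)_{k\in\mathbb{N}}\in c_0(\mathbb{N})\right\}. \] Furthermore, each $\lambda\in\mathbb{F}$ is an eigenvalue of $\hat{A}_w$ of geometric multiplicity $1$, i.e., \[ \dim\ker(\hat{A}_w-\lambda I)=1. \]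
   Context: $\mathbb{N}=\{1,2,3,\dots\}$, $\mathbb{Z}_+=\{0,1,2,\dots\}$. $c(\mathbb{N})$ is the Banach space of $\mathbb{F}$-valued sequences $x=(x_k)_{k\in\mathbb{N}}$ for which the limit $l(x):=\lim_{k\to\infty}x_k$ exists in $\mathbb{F}$, with the norm $\|x\|_\infty=\sup_{k\in\mathbb{N}}|x_k|$; $c_0(\mathbb{N})$ is its subspace of sequences with limit $0$. Powers of an unbounded operator $A$ with domain $D(A)$ have their natural domains: $A^0:=I$ and $D(A^{n+1})=\{x\in D(A^n): A^nx\in D(A)\}$. For a (bounded or unbounded) linear operator $A$ with domain $D(A)$ in a real or complex Banach space $X$, put $C^\infty(A):=\bigcap_{n=0}^\infty D(A^n)$. A nonzero vector $x\in C^\infty(A)$ is hypercyclic for $A$ if its orbit $\{A^nx\}_{n\in\mathbb{Z}_+}$ is dense in $X$; $A$ is hypercyclic if it possesses a hypercyclic vector. A vector $x\in D(A^N)$ with $A^Nx=x$ for some $N\in\mathbb{N}$ is a periodic point of $A$. $A$ is chaotic if it is hypercyclic and the set of its periodic points is dense in $X$. *)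

theory Defs
  imports "HOL-Analysis.Analysis"
begin

section \<open>Unbounded operators\<close>

text \<open>
  A partially defined operator is given by its domain \<open>D\<close> and a total function \<open>A\<close>
  whose values outside \<open>D\<close> are never used. Its powers are the functions \<open>A ^^ n\<close> on the
  natural domains \<open>pow_dom D A n\<close>.
\<close>

primrec pow_dom :: "'x set \<Rightarrow> ('x \<Rightarrow> 'x) \<Rightarrow> nat \<Rightarrow> 'x set" where
  "pow_dom D A 0 = UNIV"
| "pow_dom D A (Suc n) = {x \<in> pow_dom D A n. (A ^^ n) x \<in> D}"

definition C_infinity :: "'x set \<Rightarrow> ('x \<Rightarrow> 'x) \<Rightarrow> 'x set" where
  "C_infinity D A = (\<Inter>n. pow_dom D A n)"

definition linear_operator ::
  "('f::field \<Rightarrow> 'x \<Rightarrow> 'x) \<Rightarrow> 'x::ab_group_add set \<Rightarrow> ('x \<Rightarrow> 'x) \<Rightarrow> bool" where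
  "linear_operator smul D A \<longleftrightarrow>
     module.subspace smul D \<and>
     (\<forall>x\<in>D. \<forall>y\<in>D. A (x + y) = A x + A y) \<and>
     (\<forall>c. \<forall>x\<in>D. A (smul c x) = smul c (A x))"

definition unbounded_operator :: "'x::real_normed_vector set \<Rightarrow> ('x \<Rightarrow> 'x) \<Rightarrow> bool" where
  "unbounded_operator D A \<longleftrightarrow> \<not> (\<exists>C. \<forall>x\<in>D. norm (A x) \<le> C * norm x)"

definition closed_operator :: "'x::real_normed_vector set \<Rightarrow> ('x \<Rightarrow> 'x) \<Rightarrow> bool" where
  "closed_operator D A \<longleftrightarrow> closed {(x, A x) | x. x \<in> D}"

definition hypercyclic_vector :: "'x::real_normed_vector set \<Rightarrow> ('x \<Rightarrow> 'x) \<Rightarrow> 'x \<Rightarrow> bool" where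
  "hypercyclic_vector D A x \<longleftrightarrow>
     x \<noteq> 0 \<and> x \<in> C_infinity D A \<and> closure (range (\<lambda>n. (A ^^ n) x)) = UNIV"

definition hypercyclic :: "'x::real_normed_vector set \<Rightarrow> ('x \<Rightarrow> 'x) \<Rightarrow> bool" where
  "hypercyclic D A \<longleftrightarrow> (\<exists>x. hypercyclic_vector D A x)"

definition periodic_points :: "'x set \<Rightarrow> ('x \<Rightarrow> 'x) \<Rightarrow> 'x set" where
  "periodic_points D A = {x. \<exists>N\<ge>1. x \<in> pow_dom D A N \<and> (A ^^ N) x = x}"

definition chaotic :: "'x::real_normed_vector set \<Rightarrow> ('x \<Rightarrow> 'x) \<Rightarrow> bool" where
  "chaotic D A \<longleftrightarrow> hypercyclic D A \<and> closure (periodic_points D A) = UNIV"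

definition eigenvalue ::
  "('f \<Rightarrow> 'x \<Rightarrow> 'x) \<Rightarrow> 'x::zero set \<Rightarrow> ('x \<Rightarrow> 'x) \<Rightarrow> 'f \<Rightarrow> bool" where
  "eigenvalue smul D A c \<longleftrightarrow> (\<exists>x\<in>D. x \<noteq> 0 \<and> A x = smul c x)"

definition eigenspace ::
  "('f \<Rightarrow> 'x \<Rightarrow> 'x) \<Rightarrow> 'x::ab_group_add set \<Rightarrow> ('x \<Rightarrow> 'x) \<Rightarrow> 'f \<Rightarrow> 'x set" where
  "eigenspace smul D A c = {x \<in> D. A x - smul c x = 0}"


section \<open>The Banach space of convergent sequences\<close>

text \<open>
  Sequences are indexed by \<open>1, 2, 3, \<dots>\<close>. They are represented by functions on \<^typ>\<open>nat\<close>
  whose entry at the unused index 0 is fixed to be 0.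

  The scalar field is a type variable. The fields of sort
  \<open>{real_normed_field, euclidean_space}\<close> are, up to isometric isomorphism, exactly
  \<^typ>\<open>real\<close> and \<^typ>\<open>complex\<close>.
\<close>

typedef (overloaded) 'a conv_seq =
  "{x :: nat \<Rightarrow> 'a::real_normed_field. x 0 = 0 \<and> convergent x}"
  morphisms coord Abs_conv_seq
  by (rule exI[of _ "\<lambda>_. 0"]) (simp add: convergent_const)

text \<open>The sequence \<open>(f k)\<close>, \<open>k \<ge> 1\<close>; meaningful if \<open>f\<close> converges.\<close>

definition conv_seq :: "(nat \<Rightarrow> 'a) \<Rightarrow> 'a::real_normed_field conv_seq" where
  "conv_seq f = Abs_conv_seq (\<lambda>k. if k = 0 then 0 else f k)"

definition limit :: "'a::real_normed_field conv_seq \<Rightarrow> 'a" where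
  "limit x = lim (coord x)"

lemma coord_0 [simp]: "coord x 0 = 0"
  using coord[of x] by simp

lemma convergent_coord: "convergent (coord x)"
  using coord[of x] by simp

lemma coord_tendsto_limit: "coord x \<longlonglongrightarrow> limit x"
  using convergent_coord unfolding limit_def by (simp add: convergent_LIMSEQ_iff)

lemma coord_conv_seq:
  assumes "convergent f"
  shows "coord (conv_seq f) k = (if k = 0 then 0 else f k)"
proof -
  obtain L where L: "f \<longlonglongrightarrow> L"
    using assms by (auto simp: convergent_def)
  have "(\<lambda>k. if k = 0 then 0 else f k) \<longlonglongrightarrow> L"
    by (rule Lim_transform_eventually[OF L], rule eventually_sequentiallyI[of 1]) simp
  then show ?thesis
    unfolding conv_seq_def by (subst Abs_conv_seq_inverse) (auto simp: convergent_def)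
qed

lemma conv_seq_eqI: "(\<And>k. k \<ge> 1 \<Longrightarrow> coord x k = coord y k) \<Longrightarrow> x = y"
  by (metis One_nat_def Suc_le_eq coord_0 coord_inject ext not_gr_zero)

instantiation conv_seq :: (real_normed_field) real_normed_vector
begin

definition zero_conv_seq :: "'a conv_seq" where
  "0 = conv_seq (\<lambda>k. 0)"
definition plus_conv_seq :: "'a conv_seq \<Rightarrow> 'a conv_seq \<Rightarrow> 'a conv_seq" where
  "x + y = conv_seq (\<lambda>k. coord x k + coord y k)"
definition uminus_conv_seq :: "'a conv_seq \<Rightarrow> 'a conv_seq" where
  "- x = conv_seq (\<lambda>k. - coord x k)"
definition minus_conv_seq :: "'a conv_seq \<Rightarrow> 'a conv_seq \<Rightarrow> 'a conv_seq" where
  "x - y = conv_seq (\<lambda>k. coord x k - coord y k)"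
definition scaleR_conv_seq :: "real \<Rightarrow> 'a conv_seq \<Rightarrow> 'a conv_seq" where
  "r *\<^sub>R x = conv_seq (\<lambda>k. r *\<^sub>R coord x k)"
definition norm_conv_seq :: "'a conv_seq \<Rightarrow> real" where
  "norm x = (SUP k\<in>{1..}. norm (coord x k))"
definition dist_conv_seq_def:
  "dist (x :: 'a conv_seq) y = norm (x - y)"
definition sgn_conv_seq_def:
  "sgn (x :: 'a conv_seq) = inverse (norm x) *\<^sub>R x"
definition uniformity_conv_seq_def:
  "uniformity = (INF e\<in>{0<..}. principal {(x, y :: 'a conv_seq). dist x y < e})"
definition open_conv_seq_def:
  "open (U :: 'a conv_seq set) = (\<forall>x\<in>U. \<forall>\<^sub>F (x', y) in uniformity. x' = x \<longrightarrow> y \<in> U)"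

lemma coord_zero: "coord (0 :: 'a conv_seq) k = 0"
  unfolding zero_conv_seq_def by (subst coord_conv_seq) (auto simp: convergent_const)

lemma coord_plus: "coord (x + y :: 'a conv_seq) k = coord x k + coord y k"
  unfolding plus_conv_seq_def
  by (subst coord_conv_seq) (auto intro: convergent_add convergent_coord)

lemma coord_uminus: "coord (- x :: 'a conv_seq) k = - coord x k"
proof -
  have "convergent (\<lambda>k. - coord x k)"
    using tendsto_minus[OF coord_tendsto_limit] by (auto simp: convergent_def)
  then show ?thesis
    unfolding uminus_conv_seq_def by (simp add: coord_conv_seq)
qed

lemma coord_minus: "coord (x - y :: 'a conv_seq) k = coord x k - coord y k"
  unfolding minus_conv_seq_def
  by (subst coord_conv_seq) (auto intro: convergent_diff convergent_coord)

lemma coord_scaleR: "coord (r *\<^sub>R x :: 'a conv_seq) k = r *\<^sub>R coord x k"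
proof -
  have "convergent (\<lambda>k. r *\<^sub>R coord x k)"
    using tendsto_scaleR[OF tendsto_const coord_tendsto_limit] by (auto simp: convergent_def)
  then show ?thesis
    unfolding scaleR_conv_seq_def by (simp add: coord_conv_seq)
qed

lemma norm_coord_bdd: "bdd_above ((\<lambda>k. norm (coord (x :: 'a conv_seq) k)) ` A)"
proof -
  obtain K where "\<And>k. norm (coord x k) \<le> K"
    using convergent_imp_Bseq[OF convergent_coord[of x]] by (metis BseqE)
  then show ?thesis
    by (rule bdd_aboveI2)
qed

lemma norm_coord_le: "norm (coord (x :: 'a conv_seq) k) \<le> norm x"
proof -
  have le: "norm (coord x j) \<le> norm x" if "j \<ge> 1" for j
    unfolding norm_conv_seq_def using that by (intro cSUP_upper norm_coord_bdd) auto
  show ?thesis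
  proof (cases "k = 0")
    case True
    then show ?thesis
      using order_trans[OF norm_ge_zero le[of 1]] by simp
  next
    case False
    then show ?thesis
      using le[of k] by simp
  qed
qed

lemma norm_conv_seq_le:
  "(\<And>k. k \<ge> 1 \<Longrightarrow> norm (coord (x :: 'a conv_seq) k) \<le> b) \<Longrightarrow> norm x \<le> b"
  unfolding norm_conv_seq_def by (rule cSUP_least) auto

instance
proof
  fix x y z :: "'a conv_seq" and r s :: real
  show "x + y + z = x + (y + z)" "x + y = y + x" "0 + x = x" "- x + x = 0" "x - y = x + - y"
    by (rule conv_seq_eqI, simp add: coord_plus coord_zero coord_uminus coord_minus)+
  show "r *\<^sub>R (x + y) = r *\<^sub>R x + r *\<^sub>R y" "(r + s) *\<^sub>R x = r *\<^sub>R x + s *\<^sub>R x"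
    "r *\<^sub>R s *\<^sub>R x = (r * s) *\<^sub>R x" "1 *\<^sub>R x = x"
    by (rule conv_seq_eqI, simp add: coord_plus coord_scaleR algebra_simps)+
  show "dist (x :: 'a conv_seq) y = norm (x - y)"
    by (simp add: dist_conv_seq_def)
  show "sgn x = inverse (norm x) *\<^sub>R x"
    by (simp add: sgn_conv_seq_def)
  show "uniformity = (INF e\<in>{0<..}. principal {(x, y :: 'a conv_seq). dist x y < e})"
    by (simp add: uniformity_conv_seq_def)
  show "open U = (\<forall>x\<in>U. \<forall>\<^sub>F (x', y) in uniformity. x' = x \<longrightarrow> y \<in> U)" for U :: "'a conv_seq set"
    by (simp add: open_conv_seq_def)
  show "norm x = 0 \<longleftrightarrow> x = 0"
  proof
    assume "norm x = 0"
    then have "coord x k = 0" for k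
      using norm_coord_le[of x k] by simp
    then show "x = 0"
      by (intro conv_seq_eqI) (simp add: coord_zero)
  next
    assume "x = 0"
    then show "norm x = 0"
      by (simp add: norm_conv_seq_def coord_zero)
  qed
  show "norm (x + y) \<le> norm x + norm y"
  proof (rule norm_conv_seq_le)
    fix k
    have "norm (coord x k + coord y k) \<le> norm (coord x k) + norm (coord y k)"
      by (rule norm_triangle_ineq)
    also have "\<dots> \<le> norm x + norm y"
      by (intro add_mono norm_coord_le)
    finally show "norm (coord (x + y) k) \<le> norm x + norm y"
      by (simp add: coord_plus)
  qed
  have scale_le: "norm (r *\<^sub>R x) \<le> \<bar>r\<bar> * norm x" for r and x :: "'a conv_seq"
    by (rule norm_conv_seq_le) (simp add: coord_scaleR mult_left_mono norm_coord_le)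
  show "norm (r *\<^sub>R x) = \<bar>r\<bar> * norm x"
  proof (cases "r = 0")
    case True
    then show ?thesis
      by (simp add: norm_conv_seq_def coord_scaleR)
  next
    case False
    have "inverse r *\<^sub>R r *\<^sub>R x = x"
      using False by (intro conv_seq_eqI) (simp add: coord_scaleR)
    then have "norm x \<le> \<bar>inverse r\<bar> * norm (r *\<^sub>R x)"
      using scale_le[of "inverse r" "r *\<^sub>R x"] by simp
    then have "\<bar>r\<bar> * norm x \<le> norm (r *\<^sub>R x)"
      using False by (simp add: field_simps)
    then show ?thesis
      using scale_le[of r x] by simp
  qed
qed

end

lemma norm_limit_le: "norm (limit x) \<le> norm x"
  by (rule Lim_bounded[OF tendsto_norm[OF coord_tendsto_limit], of 0]) (simp add: norm_coord_le)

instance conv_seq :: ("{real_normed_field, banach}") banach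
proof
  fix X :: "nat \<Rightarrow> 'a conv_seq"
  assume X: "Cauchy X"
  have unif: "uniformly_Cauchy_on UNIV (\<lambda>n. coord (X n))"
    unfolding uniformly_Cauchy_on_def
  proof (intro allI impI)
    fix e :: real
    assume "e > 0"
    then obtain M where M: "\<forall>m\<ge>M. \<forall>n\<ge>M. dist (X m) (X n) < e"
      using X unfolding Cauchy_def by blast
    have "dist (coord (X m) k) (coord (X n) k) \<le> dist (X m) (X n)" for m n k
      using norm_coord_le[of "X m - X n" k] by (simp add: dist_norm coord_minus)
    then show "\<exists>M. \<forall>x\<in>UNIV. \<forall>m\<ge>M. \<forall>n\<ge>M. dist (coord (X m) x) (coord (X n) x) < e"
      using M by (meson le_less_trans)
  qed
  then obtain f where f: "uniform_limit UNIV (\<lambda>n. coord (X n)) f sequentially"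
    using Cauchy_uniformly_convergent uniformly_convergent_on_def by blast
  have "Cauchy f"
  proof (rule metric_CauchyI)
    fix e :: real
    assume "e > 0"
    then obtain n where n: "\<And>k. dist (coord (X n) k) (f k) < e / 3"
      using uniform_limitD[OF f, of "e / 3"] by (auto simp: eventually_sequentially)
    obtain M where M: "\<And>j k. j \<ge> M \<Longrightarrow> k \<ge> M \<Longrightarrow> dist (coord (X n) j) (coord (X n) k) < e / 3"
      using metric_CauchyD[OF convergent_Cauchy[OF convergent_coord[of "X n"]], of "e / 3"] \<open>e > 0\<close>
      by auto
    have "dist (f j) (f k) < e" if "j \<ge> M" "k \<ge> M" for j k
      using n[of j] n[of k] M[OF that]
        dist_triangle[of "f j" "f k" "coord (X n) j"]
        dist_triangle[of "coord (X n) j" "f k" "coord (X n) k"]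
      by (simp add: dist_commute)
    then show "\<exists>M. \<forall>m\<ge>M. \<forall>n\<ge>M. dist (f m) (f n) < e"
      by blast
  qed
  then have conv: "convergent f"
    by (rule Cauchy_convergent)
  have "X \<longlonglongrightarrow> conv_seq f"
  proof (rule metric_LIMSEQ_I)
    fix e :: real
    assume "e > 0"
    then obtain M where M: "\<And>n k. n \<ge> M \<Longrightarrow> dist (coord (X n) k) (f k) < e / 2"
      using uniform_limitD[OF f, of "e / 2"] by (auto simp: eventually_sequentially)
    have "norm (X n - conv_seq f) \<le> e / 2" if "n \<ge> M" for n
      using M[OF that]
      by (intro norm_conv_seq_le)
        (auto simp: coord_minus coord_conv_seq[OF conv] dist_norm intro: less_imp_le)
    then show "\<exists>M. \<forall>n\<ge>M. dist (X n) (conv_seq f) < e"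
      using \<open>e > 0\<close> by (intro exI[of _ M]) (fastforce simp: dist_norm)
  qed
  then show "convergent X"
    by (auto simp: convergent_def)
qed

text \<open>Multiplication by elements of the scalar field itself, which need not be real.\<close>

definition scaleF :: "'a \<Rightarrow> 'a conv_seq \<Rightarrow> 'a::real_normed_field conv_seq" where
  "scaleF c x = conv_seq (\<lambda>k. c * coord x k)"

lemma coord_scaleF: "coord (scaleF c x) k = c * coord x k"
proof -
  have "convergent (\<lambda>k. c * coord x k)"
    using tendsto_mult[OF tendsto_const coord_tendsto_limit] by (auto simp: convergent_def)
  then show ?thesis
    unfolding scaleF_def by (simp add: coord_conv_seq)
qed

lemma vector_space_scaleF: "vector_space scaleF"
  by unfold_locales (rule conv_seq_eqI, simp add: coord_scaleF coord_plus algebra_simps)+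


section \<open>The operator\<close>

definition A_dom :: "'a \<Rightarrow> 'a::real_normed_field conv_seq set" where
  "A_dom w = {x. (\<lambda>k. w ^ k * (coord x (k + 1) - limit x)) \<longlonglongrightarrow> 0}"

definition A_op :: "'a \<Rightarrow> 'a conv_seq \<Rightarrow> 'a::real_normed_field conv_seq" where
  "A_op w x = conv_seq (\<lambda>k. w ^ k * (coord x (k + 1) - limit x) + coord x 1 - limit x)"

lemma coord_A_op:
  assumes "x \<in> A_dom w" and "k \<ge> 1"
  shows "coord (A_op w x) k = w ^ k * (coord x (k + 1) - limit x) + coord x 1 - limit x"
proof -
  have "(\<lambda>k. w ^ k * (coord x (k + 1) - limit x) + coord x 1 - limit x)
          \<longlonglongrightarrow> 0 + coord x 1 - limit x"
    using assms(1) unfolding A_dom_def by (intro tendsto_intros) simp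
  then show ?thesis
    using assms(2) unfolding A_op_def by (subst coord_conv_seq) (auto simp: convergent_def)
qed

end

theory Submission
  imports Defs
begin

text \<open>
  The operator is a disguised backward shift. For a convergent sequence \<open>x\<close> with limit \<open>l\<close> put
  \<open>y\<^sub>0 = l\<close> and \<open>y\<^sub>k = x\<^sub>k - l\<close> for \<open>k \<ge> 1\<close>. This identifies the convergent sequences,
  up to an equivalent norm, with the null sequences indexed from \<open>0\<close>. The limit of the image
  of \<open>x\<close> is \<open>x\<^sub>1 - l = y\<^sub>1\<close>, so the operator becomes the weighted backward shift
  \<open>(y\<^sub>k) \<mapsto> (w^k y\<^sub>k\<^sub>+\<^sub>1)\<close>, also at \<open>k = 0\<close>. The further substitution
  \<open>a\<^sub>k = w^(0 + 1 + \<dots> + (k - 1)) y\<^sub>k\<close> removes the weights: in these coordinates the \<open>n\<close>-th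
  power is \<open>(a\<^sub>k) \<mapsto> (a\<^sub>k\<^sub>+\<^sub>n)\<close>, and a sequence \<open>a\<close> comes from a vector, or from a vector in the
  domain of the \<open>n\<close>-th power, if and only if \<open>a\<^sub>k\<close>, respectively \<open>a\<^sub>k\<^sub>+\<^sub>n\<close>, divided by
  \<open>w^(0 + 1 + \<dots> + (k - 1))\<close> tends to \<open>0\<close> (lemmas \<open>ex_shift_coord\<close>, \<open>pow_dom_iff\<close> and
  \<open>shift_coord_funpow\<close>).

  The divisor grows faster than every geometric sequence, so all the dynamics can be read off
  from plain sequences. The formula for the powers is the substitution undone, and closedness
  holds because each coordinate depends continuously on the vector. The eigenvectors for \<open>c\<close> are
  the multiples of the geometric sequence \<open>(c^k)\<close>, which is admissible for every \<open>c\<close>; since there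
  are arbitrarily large eigenvalues, no power is bounded. Periodic points are the periodic
  sequences, and repeating a long initial piece of \<open>a\<close> with a long period changes the vector
  little, because the repetitions are divided by huge weights (\<open>periodic_points_dense\<close>).
  A hypercyclic vector is a sequence in which every finite word over a countable dense set of
  scalars occurs infinitely often, with gaps of zeros so long that, once a word has been shifted
  to the front, all later words are negligible (\<open>universal_sequence\<close>). If the words start at
  multiples of \<open>n\<close>, the orbit under the \<open>n\<close>-th power is already dense.
\<close>

section \<open>Convergent sequences in shift coordinates\<close>

text \<open>The closed form is \<open>w^(k (k - 1) / 2)\<close>.\<close>

definition weight :: "'a::real_normed_field \<Rightarrow> nat \<Rightarrow> 'a" where
  "weight w k = (\<Prod>j<k. w ^ j)"

text \<open>
  Entry \<open>0\<close>, which is free in the representation of sequences indexed from \<open>1\<close>, carries the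
  limit.
\<close>

definition shift_coord :: "'a \<Rightarrow> 'a conv_seq \<Rightarrow> nat \<Rightarrow> 'a::real_normed_field" where
  "shift_coord w x k = weight w k * (if k = 0 then limit x else coord x k - limit x)"

lemma weight_0 [simp]: "weight w 0 = 1"
  and weight_Suc: "weight w (Suc k) = weight w k * w ^ k"
  by (simp_all add: weight_def)

text \<open>
  Quotients of weights are the products in the formula for the powers of the operator.
\<close>

lemma weight_add: "weight w (k + n) = weight w k * (\<Prod>j=k..<k+n. w ^ j)"
  by (induction n) (simp_all add: weight_Suc mult_ac)

lemma limit_eqI: "coord x \<longlonglongrightarrow> L \<Longrightarrow> limit x = L"
  unfolding limit_def by (rule limI)

lemma limit_plus: "limit (x + y) = limit x + limit y"
  by (rule limit_eqI)
    (simp add: coord_plus[abs_def] tendsto_add coord_tendsto_limit)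

lemma limit_minus: "limit (x - y) = limit x - limit y"
  by (rule limit_eqI)
    (simp add: coord_minus[abs_def] tendsto_diff coord_tendsto_limit)

lemma limit_scaleF: "limit (scaleF c x) = c * limit x"
  by (rule limit_eqI)
    (simp add: coord_scaleF[abs_def] tendsto_mult coord_tendsto_limit)

lemma shift_coord_plus: "shift_coord w (x + y) k = shift_coord w x k + shift_coord w y k"
  by (simp add: shift_coord_def limit_plus coord_plus algebra_simps)

lemma shift_coord_minus: "shift_coord w (x - y) k = shift_coord w x k - shift_coord w y k"
  by (simp add: shift_coord_def limit_minus coord_minus algebra_simps)

lemma shift_coord_scaleF: "shift_coord w (scaleF c x) k = c * shift_coord w x k"
  by (simp add: shift_coord_def limit_scaleF coord_scaleF algebra_simps)

lemma shift_coord_zero: "shift_coord w 0 k = 0"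
  using shift_coord_minus[of w 0 0 k] by simp

lemma norm_scaleF: "norm (scaleF c x) = norm c * norm x"
proof (cases "c = 0")
  case True
  then have "scaleF c x = 0"
    by (intro conv_seq_eqI) (simp add: coord_scaleF coord_zero)
  with True show ?thesis by simp
next
  case False
  have "norm x \<le> norm (scaleF c x) / norm c"
    using norm_coord_le[of "scaleF c x"] False
    by (intro norm_conv_seq_le) (simp add: coord_scaleF norm_mult field_simps)
  moreover have "norm (scaleF c x) \<le> norm c * norm x"
    by (rule norm_conv_seq_le) (simp add: coord_scaleF norm_mult mult_left_mono norm_coord_le)
  ultimately show ?thesis
    using False by (simp add: field_simps)
qed

context
  fixes w :: "'a::real_normed_field"
  assumes w: "norm w > 1"
begin

lemma weight_nonzero: "weight w k \<noteq> 0"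
  using w by (auto simp: weight_def)

lemma weight_mono: "k \<le> m \<Longrightarrow> norm (weight w k) \<le> norm (weight w m)"
proof (rule lift_Suc_mono_le)
  fix k
  have "norm (weight w k) * 1 \<le> norm (weight w k) * norm (w ^ k)"
    using w by (intro mult_left_mono) (auto simp: norm_power one_le_power)
  then show "norm (weight w k) \<le> norm (weight w (Suc k))"
    by (simp add: weight_Suc norm_mult)
qed

lemma weight_ge_1: "1 \<le> norm (weight w k)"
  using weight_mono[of 0 k] by simp

lemma norm_power_at_top: "filterlim (\<lambda>k. norm w ^ k) at_top sequentially"
proof (rule filterlim_at_infinity_imp_filterlim_at_top)
  show "filterlim (\<lambda>k. norm w ^ k) at_infinity sequentially"
    using w by (intro filterlim_realpow_sequentially_gt1) simp
  show "\<forall>\<^sub>F k in sequentially. 0 < norm w ^ k"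
    using less_trans[OF zero_less_one w] by (intro always_eventually allI zero_less_power)
qed

lemma weight_at_top: "filterlim (\<lambda>k. norm (weight w k)) at_top sequentially"
proof -
  note norm_power_at_top
  moreover have "\<forall>\<^sub>F k in sequentially. norm w ^ k \<le> norm (weight w (Suc k))"
  proof (intro always_eventually allI)
    fix k
    show "norm w ^ k \<le> norm (weight w (Suc k))"
      using mult_right_mono[OF weight_ge_1[of k], of "norm w ^ k"]
      by (simp add: weight_Suc norm_mult norm_power)
  qed
  ultimately have "filterlim (\<lambda>k. norm (weight w (Suc k))) at_top sequentially"
    by (rule filterlim_at_top_mono)
  then show ?thesis
    by (rule filterlim_sequentially_Suc[THEN iffD1])
qed

lemma coord_eq_shift_coord:
  "k \<ge> 1 \<Longrightarrow> coord x k = shift_coord w x k / weight w k + shift_coord w x 0"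
  by (simp add: shift_coord_def weight_nonzero)

lemma shift_coord_inject: "(\<And>k. shift_coord w x k = shift_coord w y k) \<Longrightarrow> x = y"
  by (rule conv_seq_eqI) (simp add: coord_eq_shift_coord)

lemma shift_coord_tendsto: "(\<lambda>k. shift_coord w x k / weight w k) \<longlonglongrightarrow> 0"
proof (rule Lim_transform_eventually)
  show "(\<lambda>k. coord x k - limit x) \<longlonglongrightarrow> 0"
    using tendsto_diff[OF coord_tendsto_limit[of x] tendsto_const[of "limit x"]] by simp
  show "\<forall>\<^sub>F k in sequentially. coord x k - limit x = shift_coord w x k / weight w k"
    by (rule eventually_sequentiallyI[of 1]) (simp add: shift_coord_def weight_nonzero)
qed

text \<open>
  The inverse coordinate change: \<open>a\<^sub>0\<close> is the limit that has to be added back.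
\<close>

lemma ex_shift_coord:
  assumes "(\<lambda>k. a k / weight w k) \<longlonglongrightarrow> 0"
  obtains x where "shift_coord w x = a"
proof
  define f where "f k = a k / weight w k + a 0" for k
  have f: "f \<longlonglongrightarrow> a 0"
    using tendsto_add[OF assms tendsto_const[of "a 0"]] by (simp add: f_def[abs_def])
  then have conv: "convergent f"
    by (auto simp: convergent_def)
  have "coord (conv_seq f) \<longlonglongrightarrow> a 0"
    by (rule Lim_transform_eventually[OF f], rule eventually_sequentiallyI[of 1])
      (simp add: coord_conv_seq[OF conv])
  then have "limit (conv_seq f) = a 0"
    by (rule limit_eqI)
  then show "shift_coord w (conv_seq f) = a"
    by (intro ext) (simp add: shift_coord_def coord_conv_seq[OF conv] f_def weight_nonzero)
qed

text \<open>
  Together with the next lemma this says that the supremum norm of the rescaled coordinates is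
  equivalent to the given norm. Each factor \<open>2\<close> comes from subtracting or adding the limit.
\<close>

lemma norm_shift_coord_le: "norm (shift_coord w x k / weight w k) \<le> 2 * norm x"
  using norm_triangle_ineq4[of "coord x k" "limit x"] norm_coord_le[of x k] norm_limit_le[of x]
    norm_ge_zero[of x]
  by (auto simp: shift_coord_def weight_nonzero simp del: norm_ge_zero)

lemma norm_le_shift_coord:
  assumes "\<And>k. norm (shift_coord w x k / weight w k) \<le> b"
  shows "norm x \<le> 2 * b"
proof (rule norm_conv_seq_le)
  fix k :: nat assume "k \<ge> 1"
  then show "norm (coord x k) \<le> 2 * b"
    using norm_triangle_ineq[of "shift_coord w x k / weight w k" "shift_coord w x 0"]
      assms[of k] assms[of 0]
    by (simp add: coord_eq_shift_coord)
qed

lemma tendsto_shift_coord: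
  assumes "X \<longlonglongrightarrow> x"
  shows "(\<lambda>i. shift_coord w (X i) k) \<longlonglongrightarrow> shift_coord w x k"
proof (rule LIM_zero_cancel, rule tendsto_norm_zero_cancel,
    rule tendsto_sandwich[OF _ _ tendsto_const])
  have "norm (shift_coord w (X i) k - shift_coord w x k)
      \<le> norm (weight w k) * (2 * norm (X i - x))" for i
    using norm_shift_coord_le[of "X i - x" k] weight_nonzero[of k]
    by (simp add: shift_coord_minus norm_divide field_simps)
  then show "\<forall>\<^sub>F i in sequentially. norm (shift_coord w (X i) k - shift_coord w x k)
      \<le> norm (weight w k) * (2 * norm (X i - x))"
    by simp
  show "(\<lambda>i. norm (weight w k) * (2 * norm (X i - x))) \<longlonglongrightarrow> 0"
    using tendsto_mult_right_zero[OF tendsto_norm_zero[OF LIM_zero[OF assms]],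
        of "norm (weight w k) * 2"]
    by (simp add: mult_ac)
qed simp


section \<open>The powers of the operator as shifts\<close>

lemma A_dom_iff: "x \<in> A_dom w \<longleftrightarrow> (\<lambda>k. shift_coord w x (Suc k) / weight w k) \<longlonglongrightarrow> 0"
  by (simp add: A_dom_def shift_coord_def weight_Suc weight_nonzero)

text \<open>
  At \<open>k \<ge> 1\<close> the summand \<open>x\<^sub>1 - l\<close> of the operator is the limit of the image and cancels; at
  \<open>k = 0\<close> that limit is itself the shifted coordinate, since \<open>weight w 1 = 1\<close>.
\<close>

lemma shift_coord_A_op:
  assumes "x \<in> A_dom w"
  shows "shift_coord w (A_op w x) k = shift_coord w x (Suc k)"
proof -
  have "(\<lambda>k. w ^ k * (coord x (k + 1) - limit x) + coord x 1 - limit x)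
      \<longlonglongrightarrow> 0 + coord x 1 - limit x"
    using assms unfolding A_dom_def by (intro tendsto_intros) simp
  then have "coord (A_op w x) \<longlonglongrightarrow> 0 + coord x 1 - limit x"
    by (rule Lim_transform_eventually, intro eventually_sequentiallyI[of 1])
      (simp add: coord_A_op[OF assms])
  then have "limit (A_op w x) = coord x 1 - limit x"
    by (auto dest: limit_eqI)
  then show ?thesis
    by (simp add: shift_coord_def coord_A_op[OF assms] weight_Suc)
qed

text \<open>
  The natural domain of a power is an intersection of conditions, one for each iterate. As the
  weights increase in modulus, the condition for the last iterate implies the earlier ones.
\<close>

lemma shifted_tendsto_antimono:
  assumes "(\<lambda>k. a (k + n) / weight w k) \<longlonglongrightarrow> 0" and "m \<le> n"
  shows "(\<lambda>k. a (k + m) / weight w k) \<longlonglongrightarrow> 0"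
proof -
  have "(\<lambda>k. a (k + n) / weight w (k + (n - m))) \<longlonglongrightarrow> 0"
    by (rule Lim_null_comparison[OF _ tendsto_norm_zero[OF assms(1)]])
      (simp add: norm_divide divide_left_mono weight_mono weight_nonzero)
  then have "(\<lambda>k. a (k + (n - m) + m) / weight w (k + (n - m))) \<longlonglongrightarrow> 0"
    using assms(2) by simp
  then show ?thesis
    by (rule LIMSEQ_offset)
qed

text \<open>
  The domain of the next power is defined through the values of the current one, so the
  domains and the values have to be determined in one induction.
\<close>

lemma pow_dom_and_shift_coord_funpow:
  "(x \<in> pow_dom (A_dom w) (A_op w) n \<longleftrightarrow> (\<lambda>k. shift_coord w x (k + n) / weight w k) \<longlonglongrightarrow> 0) \<and>
   (x \<in> pow_dom (A_dom w) (A_op w) n \<longrightarrow>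
     shift_coord w ((A_op w ^^ n) x) k = shift_coord w x (k + n))"
proof (induction n arbitrary: k)
  case 0
  then show ?case
    by (simp add: shift_coord_tendsto)
next
  case (Suc n)
  let ?D = "pow_dom (A_dom w) (A_op w)"
  have dom: "x \<in> ?D n \<longleftrightarrow> (\<lambda>k. shift_coord w x (k + n) / weight w k) \<longlonglongrightarrow> 0"
    and val: "\<And>k. x \<in> ?D n \<Longrightarrow> shift_coord w ((A_op w ^^ n) x) k = shift_coord w x (k + n)"
    using Suc by blast+
  have "x \<in> ?D (Suc n) \<longleftrightarrow> (\<lambda>k. shift_coord w x (k + Suc n) / weight w k) \<longlonglongrightarrow> 0"
    using shifted_tendsto_antimono[of "shift_coord w x" "Suc n" n]
    by (auto simp: A_dom_iff val dom)
  then show ?case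
    by (auto simp: shift_coord_A_op val)
qed

lemma pow_dom_iff:
  "x \<in> pow_dom (A_dom w) (A_op w) n \<longleftrightarrow> (\<lambda>k. shift_coord w x (k + n) / weight w k) \<longlonglongrightarrow> 0"
  using pow_dom_and_shift_coord_funpow by blast

lemma shift_coord_funpow:
  "x \<in> pow_dom (A_dom w) (A_op w) n \<Longrightarrow>
    shift_coord w ((A_op w ^^ n) x) k = shift_coord w x (k + n)"
  using pow_dom_and_shift_coord_funpow by blast

lemma pow_dom_pow_dom:
  "pow_dom (pow_dom (A_dom w) (A_op w) n) (A_op w ^^ n) m = pow_dom (A_dom w) (A_op w) (n * m)"
proof (induction m)
  case 0
  then show ?case by simp
next
  case (Suc m)
  have "x \<in> pow_dom (A_dom w) (A_op w) (n * m) \<and>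
      (A_op w ^^ (n * m)) x \<in> pow_dom (A_dom w) (A_op w) n \<longleftrightarrow>
      x \<in> pow_dom (A_dom w) (A_op w) (n * Suc m)" (is "?l \<longleftrightarrow> ?r") for x
  proof -
    have "?l \<longleftrightarrow> x \<in> pow_dom (A_dom w) (A_op w) (n * m) \<and>
        (\<lambda>k. shift_coord w x (k + n * Suc m) / weight w k) \<longlonglongrightarrow> 0"
      by (auto simp: pow_dom_iff[of _ n] shift_coord_funpow add_ac)
    then show ?thesis
      using shifted_tendsto_antimono[of "shift_coord w x" "n * Suc m" "n * m"]
      by (auto simp: pow_dom_iff)
  qed
  with Suc show ?case
    by (auto simp: funpow_mult)
qed

lemma weight_ratio:
  assumes "n \<ge> 1"
  shows "(\<Prod>j=k..k+n-1. w ^ j) * (coord x (k + n) - limit x) = shift_coord w x (k + n) / weight w k"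
proof -
  have "{k..k+n-1} = {k..<k+n}"
    using assms by auto
  then show ?thesis
    using assms by (simp add: shift_coord_def weight_add weight_nonzero)
qed

lemma coord_funpow:
  assumes "n \<ge> 1" and "x \<in> pow_dom (A_dom w) (A_op w) n" and "k \<ge> 1"
  shows "coord ((A_op w ^^ n) x) k =
    (\<Prod>j=k..k+n-1. w ^ j) * (coord x (k + n) - limit x)
    + (\<Prod>j=0..n-1. w ^ j) * (coord x n - limit x)"
  using weight_ratio[OF assms(1), of k x] weight_ratio[OF assms(1), of 0 x]
  by (simp add: coord_eq_shift_coord[OF assms(3)] shift_coord_funpow[OF assms(2)])

lemma linear_operator_funpow:
  "linear_operator scaleF (pow_dom (A_dom w) (A_op w) n) (A_op w ^^ n)"
proof -
  interpret vs: vector_space scaleF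
    by (rule vector_space_scaleF)
  let ?D = "pow_dom (A_dom w) (A_op w) n"
  have add: "x + y \<in> ?D" if "x \<in> ?D" "y \<in> ?D" for x y
    using tendsto_add[OF that[unfolded pow_dom_iff]]
    by (simp add: pow_dom_iff shift_coord_plus add_divide_distrib)
  have scale: "scaleF c x \<in> ?D" if "x \<in> ?D" for c x
    using tendsto_mult_right_zero[OF that[unfolded pow_dom_iff], of c]
    by (simp add: pow_dom_iff shift_coord_scaleF)
  have "0 \<in> ?D"
    by (simp add: pow_dom_iff shift_coord_zero)
  then have "vs.subspace ?D"
    using add scale by (auto simp: vs.subspace_def)
  then show ?thesis
    unfolding linear_operator_def
    by (auto intro!: shift_coord_inject simp: shift_coord_plus shift_coord_scaleF
        shift_coord_funpow add scale)
qed

text \<open>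
  In shift coordinates the graph is cut out by the equations \<open>b\<^sub>k = a\<^sub>k\<^sub>+\<^sub>n\<close>, each of which is
  closed. The domain condition on \<open>a\<close> is then the null condition that \<open>b\<close> satisfies anyway.
\<close>

lemma closed_operator_funpow:
  "closed_operator (pow_dom (A_dom w) (A_op w) n) (A_op w ^^ n)"
  unfolding closed_operator_def closed_sequential_limits
proof (intro allI impI, elim conjE)
  let ?D = "pow_dom (A_dom w) (A_op w) n"
  fix Z and z
  assume Z: "\<forall>i. Z i \<in> {(x, (A_op w ^^ n) x) |x. x \<in> ?D}" and lim: "Z \<longlonglongrightarrow> z"
  obtain x y where z: "z = (x, y)"
    by (cases z)
  define X where "X i = fst (Z i)" for i
  have X: "X i \<in> ?D" and snd: "snd (Z i) = (A_op w ^^ n) (X i)" for i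
    using spec[OF Z, of i] by (auto simp: X_def)
  have "X \<longlonglongrightarrow> x" and AX: "(\<lambda>i. (A_op w ^^ n) (X i)) \<longlonglongrightarrow> y"
    using tendsto_fst[OF lim] tendsto_snd[OF lim] unfolding snd by (simp_all add: z X_def[abs_def])
  then have y: "shift_coord w y k = shift_coord w x (k + n)" for k
    using tendsto_shift_coord[OF \<open>X \<longlonglongrightarrow> x\<close>, of "k + n"] tendsto_shift_coord[OF AX, of k]
    by (simp add: shift_coord_funpow[OF X] LIMSEQ_unique)
  have "x \<in> ?D"
    using shift_coord_tendsto[of y] by (simp add: pow_dom_iff y)
  moreover from this have "y = (A_op w ^^ n) x"
    by (intro shift_coord_inject) (simp add: y shift_coord_funpow)
  ultimately show "z \<in> {(x, (A_op w ^^ n) x) |x. x \<in> ?D}"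
    by (auto simp: z)
qed


section \<open>Eigenvectors and unboundedness\<close>

text \<open>
  The quotient of consecutive terms is \<open>c / w^k\<close>, which is eventually at most \<open>1/2\<close> in modulus.
\<close>

lemma power_div_weight_tendsto: "(\<lambda>k. c ^ (k + n) / weight w k) \<longlonglongrightarrow> 0"
proof -
  have "\<forall>\<^sub>F k in sequentially. 2 * norm c \<le> norm w ^ k"
    using norm_power_at_top by (simp add: filterlim_at_top)
  then obtain K where K: "\<And>k. k \<ge> K \<Longrightarrow> 2 * norm c \<le> norm w ^ k"
    by (auto simp: eventually_sequentially)
  have "summable (\<lambda>k. norm (c ^ (k + n) / weight w k))"
  proof (rule summable_ratio_test[of "1/2" K])
    fix k assume "K \<le> k"
    have "0 < norm w"
      using w by linarith
    then have "0 < norm w ^ k"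
      by (rule zero_less_power)
    then have "norm (c ^ (Suc k + n) / weight w (Suc k))
        = norm c / norm w ^ k * norm (c ^ (k + n) / weight w k)"
      by (simp add: weight_Suc norm_mult norm_divide norm_power)
    also have "\<dots> \<le> 1/2 * norm (c ^ (k + n) / weight w k)"
      using K[OF \<open>K \<le> k\<close>] \<open>0 < norm w ^ k\<close> by (intro mult_right_mono) (simp_all add: field_simps)
    finally show "norm (norm (c ^ (Suc k + n) / weight w (Suc k)))
        \<le> 1/2 * norm (norm (c ^ (k + n) / weight w k))"
      by simp
  qed simp
  then show ?thesis
    by (rule tendsto_norm_zero_cancel[OF summable_LIMSEQ_zero])
qed

text \<open>
  A geometric sequence is multiplied by \<open>c\<close> when it is shifted. For \<open>c = 0\<close> the convention
  \<open>0^0 = 1\<close> gives the sequence \<open>1, 0, 0, \<dots>\<close>, which is the constant vector.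
\<close>

lemma ex_eigenvector:
  obtains x where "x \<noteq> 0" "\<And>k. shift_coord w x k = c ^ k"
    "\<And>n. x \<in> pow_dom (A_dom w) (A_op w) n" "\<And>n. (A_op w ^^ n) x = scaleF (c ^ n) x"
proof -
  obtain x where x: "shift_coord w x = (\<lambda>k. c ^ k)"
    using ex_shift_coord power_div_weight_tendsto[of c 0] by auto
  have dom: "x \<in> pow_dom (A_dom w) (A_op w) n" for n
    by (simp add: pow_dom_iff x power_div_weight_tendsto)
  show thesis
  proof
    show "x \<noteq> 0"
      using fun_cong[OF x, of 0] by (auto simp: shift_coord_zero)
    show "(A_op w ^^ n) x = scaleF (c ^ n) x" for n
      by (rule shift_coord_inject)
        (simp add: shift_coord_funpow[OF dom] shift_coord_scaleF x power_add mult.commute)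
  qed (use x dom in auto)
qed

lemma eigenvalue_A_op: "eigenvalue scaleF (A_dom w) (A_op w) c"
proof -
  obtain x where x: "x \<noteq> 0" "\<And>k. shift_coord w x k = c ^ k"
    "\<And>n. x \<in> pow_dom (A_dom w) (A_op w) n" "\<And>n. (A_op w ^^ n) x = scaleF (c ^ n) x"
    by (rule ex_eigenvector[of c]) blast
  from x(1) x(3,4)[of 1] show ?thesis
    by (auto simp: eigenvalue_def)
qed

text \<open>
  An eigenvector satisfies \<open>a\<^sub>k\<^sub>+\<^sub>1 = c a\<^sub>k\<close>, so \<open>a\<^sub>0\<close> determines it.
\<close>

lemma dim_eigenspace_A_op:
  "vector_space.dim scaleF (eigenspace scaleF (A_dom w) (A_op w) c) = 1"
proof -
  interpret vs: vector_space scaleF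
    by (rule vector_space_scaleF)
  obtain e where e: "e \<noteq> 0" "\<And>k. shift_coord w e k = c ^ k"
    "\<And>n. e \<in> pow_dom (A_dom w) (A_op w) n" "\<And>n. (A_op w ^^ n) e = scaleF (c ^ n) e"
    by (rule ex_eigenvector[of c]) blast
  have e1: "e \<in> A_dom w" "A_op w e = scaleF c e"
    using e(3,4)[of 1] by simp_all
  have lin: "scaleF d x \<in> A_dom w" "A_op w (scaleF d x) = scaleF d (A_op w x)"
    if "x \<in> A_dom w" for d x
    using linear_operator_funpow[of 1] that by (auto simp: linear_operator_def vs.subspace_def)
  have "eigenspace scaleF (A_dom w) (A_op w) c = range (\<lambda>d. scaleF d e)"
  proof (intro equalityI subsetI)
    fix x assume "x \<in> eigenspace scaleF (A_dom w) (A_op w) c"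
    then have x: "x \<in> A_dom w" "A_op w x = scaleF c x"
      by (auto simp: eigenspace_def)
    have Suc: "shift_coord w x (Suc k) = c * shift_coord w x k" for k
      using shift_coord_A_op[OF x(1), of k] by (simp add: x(2) shift_coord_scaleF)
    have geometric: "shift_coord w x k = shift_coord w x 0 * c ^ k" for k
      by (induction k) (simp_all add: Suc)
    have "x = scaleF (shift_coord w x 0) e"
    proof (rule shift_coord_inject)
      show "shift_coord w x k = shift_coord w (scaleF (shift_coord w x 0) e) k" for k
        unfolding shift_coord_scaleF e(2) by (rule geometric)
    qed
    then show "x \<in> range (\<lambda>d. scaleF d e)"
      by blast
  next
    fix x assume "x \<in> range (\<lambda>d. scaleF d e)"
    then show "x \<in> eigenspace scaleF (A_dom w) (A_op w) c"
      by (auto simp: eigenspace_def lin[OF e1(1)] e1(2) mult.commute)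
  qed
  also have "\<dots> = vs.span {e}"
    by (simp add: vs.span_singleton)
  also have "vs.dim \<dots> = 1"
    using vs.dim_eq_card_independent[of "{e}"] e(1) by simp
  finally show ?thesis .
qed

text \<open>
  A bound \<open>C\<close> would dominate the modulus of every eigenvalue, but \<open>c^n\<close> is an eigenvalue of the
  \<open>n\<close>-th power for every \<open>c\<close>; a real \<open>c > C\<close> suffices.
\<close>

lemma unbounded_operator_funpow:
  assumes "n \<ge> 1"
  shows "unbounded_operator (pow_dom (A_dom w) (A_op w) n) (A_op w ^^ n)"
  unfolding unbounded_operator_def
proof
  assume "\<exists>C. \<forall>x\<in>pow_dom (A_dom w) (A_op w) n. norm ((A_op w ^^ n) x) \<le> C * norm x"
  then obtain C where C: "\<And>x. x \<in> pow_dom (A_dom w) (A_op w) n \<Longrightarrow> norm ((A_op w ^^ n) x) \<le> C * norm x"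
    by blast
  define t where "t = 1 + \<bar>C\<bar>"
  obtain x where "x \<noteq> 0" "x \<in> pow_dom (A_dom w) (A_op w) n"
    "(A_op w ^^ n) x = scaleF (of_real t ^ n) x"
    by (rule ex_eigenvector[of "of_real t"]) blast
  then have "t ^ n \<le> C"
    using C[of x] by (simp add: norm_scaleF norm_power) (simp add: t_def)
  moreover have "t \<le> t ^ n"
    using assms by (intro self_le_power) (auto simp: t_def)
  ultimately show False
    by (simp add: t_def)
qed


section \<open>Density of the periodic points\<close>

text \<open>
  To approximate \<open>y\<close>, keep its first \<open>T\<close> coordinates, where the rescaled tail beyond \<open>T\<close> is small,
  follow them by zeros up to a length \<open>N\<close>, and repeat. The repetitions start at \<open>N\<close> and their
  entries are bounded independently of \<open>N\<close>, so for large \<open>N\<close> the weights make them small too.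
  A bounded sequence lies in the domain of every power.
\<close>

lemma periodic_points_dense:
  assumes "n \<ge> 1"
  shows "closure (periodic_points (pow_dom (A_dom w) (A_op w) n) (A_op w ^^ n)) = UNIV"
proof (intro equalityI subset_UNIV subsetI)
  fix y
  show "y \<in> closure (periodic_points (pow_dom (A_dom w) (A_op w) n) (A_op w ^^ n))"
    unfolding closure_approachable
  proof (intro allI impI)
    fix \<epsilon> :: real assume "\<epsilon> > 0"
    define \<delta> where "\<delta> = \<epsilon> / 5"
    have "\<delta> > 0"
      using \<open>\<epsilon> > 0\<close> by (simp add: \<delta>_def)
    let ?b = "shift_coord w y"
    obtain T where T: "\<And>k. k \<ge> T \<Longrightarrow> norm (?b k / weight w k) < \<delta>"
      using LIMSEQ_D[OF shift_coord_tendsto \<open>\<delta> > 0\<close>, of y] by auto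
    define B where "B = (\<Sum>i<T. norm (?b i))"
    have B: "norm (?b i) \<le> B" if "i < T" for i
      unfolding B_def using that by (intro member_le_sum) auto
    have "B \<ge> 0"
      by (simp add: B_def sum_nonneg)
    have "\<forall>\<^sub>F k in sequentially. B / \<delta> \<le> norm (weight w k)"
      using weight_at_top by (simp add: filterlim_at_top)
    then obtain K where K: "\<And>k. k \<ge> K \<Longrightarrow> B / \<delta> \<le> norm (weight w k)"
      by (auto simp: eventually_sequentially)
    \<comment> \<open>A multiple of \<open>n\<close>, so that the period is also one for the \<open>n\<close>-th power.\<close>
    define N where "N = n * (T + K + 1)"
    have N: "N \<ge> T" "N \<ge> K" "N > 0"
      using mult_le_mono1[OF assms, of "T + K + 1"] by (auto simp: N_def)
    define a where "a k = (if k mod N < T then ?b (k mod N) else 0)" for k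
    have a_le: "norm (a k) \<le> B" for k
      using B \<open>B \<ge> 0\<close> by (auto simp: a_def)
    have lim: "(\<lambda>k. a (k + m) / weight w k) \<longlonglongrightarrow> 0" for m
    proof (rule Lim_null_comparison)
      show "\<forall>\<^sub>F k in sequentially. norm (a (k + m) / weight w k) \<le> B / norm (weight w k)"
        by (simp add: norm_divide divide_right_mono a_le)
      show "(\<lambda>k. B / norm (weight w k)) \<longlonglongrightarrow> 0"
        by (rule tendsto_divide_0[OF tendsto_const filterlim_at_top_imp_at_infinity[OF weight_at_top]])
    qed
    then obtain x where x: "shift_coord w x = a"
      using ex_shift_coord[of a] lim[of 0] by auto
    have dom: "x \<in> pow_dom (A_dom w) (A_op w) N"
      by (simp add: pow_dom_iff x lim)
    have "(A_op w ^^ N) x = x"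
      by (rule shift_coord_inject) (simp add: shift_coord_funpow[OF dom] x a_def)
    with dom have "x \<in> periodic_points (pow_dom (A_dom w) (A_op w) n) (A_op w ^^ n)"
      unfolding periodic_points_def N_def
      by (auto simp: pow_dom_pow_dom funpow_mult intro!: exI[of _ "T + K + 1"])
    moreover have "norm (x - y) \<le> 2 * (2 * \<delta>)"
    proof (rule norm_le_shift_coord)
      fix k
      consider "k < T" | "T \<le> k" "k < N" | "N \<le> k" "T \<le> k"
        using N(1) by linarith
      then show "norm (shift_coord w (x - y) k / weight w k) \<le> 2 * \<delta>"
      proof cases
        case 1
        then show ?thesis
          using N \<open>\<delta> > 0\<close> by (simp add: shift_coord_minus x a_def)
      next
        case 2
        then show ?thesis
          using T[of k] \<open>\<delta> > 0\<close> by (simp add: shift_coord_minus x a_def norm_divide)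
      next
        case 3
        have "0 < norm (weight w k)"
          using weight_nonzero[of k] by simp
        moreover have "norm (a k) \<le> \<delta> * norm (weight w k)"
          using a_le[of k] K[of k] 3 N \<open>\<delta> > 0\<close> by (simp add: field_simps)
        ultimately have "norm (a k / weight w k) \<le> \<delta>"
          by (simp add: norm_divide field_simps)
        then show ?thesis
          using T[of k] 3 norm_triangle_ineq4[of "a k / weight w k" "?b k / weight w k"]
          by (simp add: shift_coord_minus x diff_divide_distrib)
      qed
    qed
    moreover have "2 * (2 * \<delta>) < \<epsilon>"
      using \<open>\<epsilon> > 0\<close> by (simp add: \<delta>_def)
    ultimately show "\<exists>x\<in>periodic_points (pow_dom (A_dom w) (A_op w) n) (A_op w ^^ n). dist x y < \<epsilon>"
      unfolding dist_norm by (meson le_less_trans)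
  qed
qed

end


section \<open>Hypercyclicity\<close>

text \<open>
  The intervals between consecutive values of \<open>M\<close> partition the natural numbers; \<open>J K\<close> is the
  index of the interval that contains \<open>K\<close>.
\<close>

lemma strict_mono_block:
  fixes M :: "nat \<Rightarrow> nat"
  assumes "strict_mono M" and "M 0 = 0"
  obtains J where "\<And>K. M (J K) \<le> K" "\<And>K. K < M (Suc (J K))"
    "\<And>K i. M i \<le> K \<Longrightarrow> i \<le> J K"
proof
  define J where "J K = Max {i. M i \<le> K}" for K
  have fin: "finite {i. M i \<le> K}" for K
    by (rule finite_subset[of _ "{..K}"])
      (auto intro: order_trans[OF strict_mono_imp_increasing[OF assms(1)]])
  show ge: "i \<le> J K" if "M i \<le> K" for K i
    unfolding J_def using that fin by (intro Max_ge) auto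
  show "M (J K) \<le> K" for K
  proof -
    have "0 \<in> {i. M i \<le> K}"
      by (simp add: assms(2))
    then have "J K \<in> {i. M i \<le> K}"
      unfolding J_def using Max_in[OF fin] by blast
    then show ?thesis
      by simp
  qed
  show "K < M (Suc (J K))" for K
    using ge[of "Suc (J K)" K] by (meson not_less Suc_n_not_le_n)
qed

text \<open>
  Enumerate the finite words over a countable dense set, each of them infinitely often, and
  write the \<open>i\<close>-th word at position \<open>M i\<close>, followed by zeros. A shift by \<open>M i\<close> moves this word to
  the front, while a later word \<open>j\<close> moves to positions at least \<open>M j - M (j - 1)\<close>. If this gap is
  chosen large in terms of the entries of word \<open>j\<close> alone, the rescaled entries are at most
  \<open>1 / (j + 1)\<close>. The supports being disjoint, these bounds need not be summed: their maximum
  over \<open>j > i\<close> controls the whole remainder, and it tends to \<open>0\<close> as \<open>i\<close> grows.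
\<close>

lemma universal_sequence:
  fixes p :: "nat \<Rightarrow> real" and n :: nat
  assumes p_top: "filterlim p at_top sequentially" and p_mono: "mono p" and p_pos: "\<And>k. p k > 0"
    and n: "n \<ge> 1"
  obtains a :: "nat \<Rightarrow> 'a::{real_normed_vector, second_countable_topology}"
  where "\<And>m. (\<lambda>k. norm (a (k + m)) / p k) \<longlonglongrightarrow> 0"
    and "\<And>b T \<epsilon>. \<epsilon> > 0 \<Longrightarrow> \<exists>m. (\<forall>k<T. norm (a (k + n * m) - b k) < \<epsilon>)
           \<and> (\<forall>k\<ge>T. norm (a (k + n * m)) / p k < \<epsilon>)"
proof -
  obtain Q :: "'a set" where Q: "countable Q" "\<And>X. open X \<Longrightarrow> X \<noteq> {} \<Longrightarrow> \<exists>d\<in>Q. d \<in> X"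
    using countable_dense_exists by metis
  \<comment> \<open>Decoding \<open>i\<close> into a pair and using its first component repeats every word infinitely often.\<close>
  define word where "word i = from_nat_into (lists Q) (fst (prod_decode i))" for i
  have "\<exists>g. \<forall>k\<ge>g. \<forall>x\<in>set (word i). real (Suc i) * norm x \<le> p k" for i
  proof -
    define S where "S = (\<Sum>x\<in>set (word i). norm x)"
    have "\<forall>\<^sub>F k in sequentially. real (Suc i) * S \<le> p k"
      using p_top by (simp add: filterlim_at_top)
    then obtain g where g: "\<And>k. k \<ge> g \<Longrightarrow> real (Suc i) * S \<le> p k"
      by (auto simp: eventually_sequentially)
    have "norm x \<le> S" if "x \<in> set (word i)" for x
      unfolding S_def using that by (intro member_le_sum) auto
    then have "real (Suc i) * norm x \<le> p k" if "x \<in> set (word i)" "k \<ge> g" for x k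
      using that g[of k] by (meson mult_left_mono of_nat_0_le_iff order_trans)
    then show ?thesis
      by blast
  qed
  then obtain g where g: "\<And>i k x. k \<ge> g i \<Longrightarrow> x \<in> set (word i) \<Longrightarrow> real (Suc i) * norm x \<le> p k"
    by metis
  \<comment> \<open>The factor \<open>n\<close> makes the positions multiples of \<open>n\<close>, and \<open>+ 1\<close> makes them strictly increasing.\<close>
  define M where "M = rec_nat 0 (\<lambda>i m. n * (m + length (word i) + g (Suc i) + 1))"
  have M_0: "M 0 = 0" and M_Suc: "M (Suc i) = n * (M i + length (word i) + g (Suc i) + 1)" for i
    by (simp_all add: M_def)
  have M_gap: "M i + length (word i) + g (Suc i) + 1 \<le> M (Suc i)" for i
    unfolding M_Suc using mult_le_mono1[OF n] by (metis mult_1)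
  have M_mono: "strict_mono M"
    unfolding strict_mono_Suc_iff
  proof
    show "M i < M (Suc i)" for i
      using M_gap[of i] by linarith
  qed
  have M_dvd: "n dvd M i" for i
    by (cases i) (simp_all add: M_0 M_Suc)
  obtain J where J: "\<And>K. M (J K) \<le> K" "\<And>K. K < M (Suc (J K))" "\<And>K i. M i \<le> K \<Longrightarrow> i \<le> J K"
    using strict_mono_block[OF M_mono M_0] by blast
  have J_eq: "J K = i" if "M i \<le> K" "K < M (Suc i)" for K i
    using J(3)[OF that(1)] J(1)[of K] that(2) M_mono
    by (meson le_antisym le_less_trans not_less_eq_eq strict_mono_less_eq leD)
  define a where "a K = (if K - M (J K) < length (word (J K)) then word (J K) ! (K - M (J K)) else 0)" for K
  have in_word: "a (k + M i) = word i ! k" if "k < length (word i)" for k i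
    using J_eq[of i "k + M i"] that M_gap[of i] by (simp add: a_def)
  have after_word: "a (k + M i) = 0 \<or> i < J (k + M i)" if "length (word i) \<le> k" for k i
    using J(3)[of i "k + M i"] that by (auto simp: a_def)
  \<comment> \<open>A shift by \<open>m\<close> moves position \<open>K\<close> to \<open>k = K - m\<close>. For all words after word \<open>i\<close> the
    bound holds under every shift with \<open>m \<le> M i\<close>: a smaller shift meets larger weights.\<close>
  have small: "norm (a K) / p k \<le> 1 / real (Suc (J K))" if "i < J K" "K \<le> k + M i" for K k i
  proof (cases "K - M (J K) < length (word (J K))")
    case True
    obtain j where j: "J K = Suc j"
      using \<open>i < J K\<close> by (cases "J K") auto
    have "M i \<le> M j"
      using \<open>i < J K\<close> M_mono by (simp add: j strict_mono_less_eq)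
    then have "g (J K) \<le> k"
      using M_gap[of j] J(1)[of K] that(2) by (simp add: j)
    moreover have "a K \<in> set (word (J K))"
      using True by (simp add: a_def)
    ultimately have "real (Suc (J K)) * norm (a K) \<le> p k"
      by (rule g)
    then show ?thesis
      using p_pos[of k] by (simp add: field_simps)
  qed (simp add: a_def)
  show thesis
  proof
    fix m
    show "(\<lambda>k. norm (a (k + m)) / p k) \<longlonglongrightarrow> 0"
    proof (rule Lim_null_comparison)
      show "\<forall>\<^sub>F k in sequentially. norm (norm (a (k + m)) / p k) \<le> 1 / real (Suc (J (k + m)))"
      proof (rule eventually_sequentiallyI[of "M (Suc m)"])
        fix k assume "M (Suc m) \<le> k"
        then have "m < J (k + m)"
          using J(3)[of "Suc m" "k + m"] by simp
        moreover have "m \<le> M m"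
          using strict_mono_imp_increasing[OF M_mono] .
        ultimately show "norm (norm (a (k + m)) / p k) \<le> 1 / real (Suc (J (k + m)))"
          using small[of m "k + m" k] p_pos[of k] by (simp add: less_imp_le)
      qed
      have "filterlim (\<lambda>k. J (k + m)) at_top sequentially"
        unfolding filterlim_at_top
      proof
        fix i
        show "\<forall>\<^sub>F k in sequentially. i \<le> J (k + m)"
          by (rule eventually_sequentiallyI[of "M i"]) (rule J(3), simp)
      qed
      from filterlim_compose[OF LIMSEQ_inverse_real_of_nat this]
      show "(\<lambda>k. 1 / real (Suc (J (k + m)))) \<longlonglongrightarrow> 0"
        by (simp add: inverse_eq_divide)
    qed
  next
    fix b :: "nat \<Rightarrow> 'a" and T :: nat and \<epsilon> :: real
    assume "\<epsilon> > 0"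
    have "\<exists>d\<in>Q. dist (b k) d < \<epsilon>" for k
      using Q(2)[of "ball (b k) \<epsilon>"] \<open>\<epsilon> > 0\<close> by auto
    then obtain d where d: "\<And>k. d k \<in> Q" "\<And>k. dist (b k) (d k) < \<epsilon>"
      by metis
    define q where "q = map d [0..<T]"
    have "q \<in> lists Q"
      using d(1) by (auto simp: q_def)
    then obtain u where u: "from_nat_into (lists Q) u = q"
      using from_nat_into_surj[OF countable_lists[OF Q(1)]] by blast
    \<comment> \<open>Among the copies of the word \<open>q\<close>, take one with an index \<open>i \<ge> v\<close>.\<close>
    obtain v where v: "1 / real (Suc v) < \<epsilon>"
      using nat_approx_posE[OF \<open>\<epsilon> > 0\<close>] by metis
    define i where "i = prod_encode (u, v)"
    have word: "word i = q"
      by (simp add: word_def i_def u)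
    obtain m where m: "M i = n * m"
      using M_dvd[of i] by (elim dvdE)
    have "norm (a (k + n * m) - b k) < \<epsilon>" if "k < T" for k
      using in_word[of k i] that d(2)[of k] by (simp add: word q_def m dist_norm norm_minus_commute)
    moreover have "norm (a (k + n * m)) / p k < \<epsilon>" if "T \<le> k" for k
    proof (cases "a (k + n * m) = 0")
      case True
      then show ?thesis
        using \<open>\<epsilon> > 0\<close> by simp
    next
      case False
      then have gt: "i < J (k + M i)"
        using after_word[of i k] that by (simp add: word q_def m)
      have "norm (a (k + M i)) / p k \<le> 1 / real (Suc (J (k + M i)))"
        by (rule small[OF gt]) simp
      also have "\<dots> \<le> 1 / real (Suc v)"
        using gt le_prod_encode_2[of v u] by (intro divide_left_mono) (auto simp: i_def)
      finally show ?thesis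
        using v by (simp add: m)
    qed
    ultimately show "\<exists>m. (\<forall>k<T. norm (a (k + n * m) - b k) < \<epsilon>)
        \<and> (\<forall>k\<ge>T. norm (a (k + n * m)) / p k < \<epsilon>)"
      by blast
  qed
qed

text \<open>
  The vector whose shift coordinates form a universal sequence is hypercyclic: among the first
  \<open>T\<close> coordinates its shifts come close to those of any prescribed vector, and beyond \<open>T\<close> both
  rescaled sequences are small.
\<close>

lemma hypercyclic_funpow:
  fixes w :: "'a::{real_normed_field, second_countable_topology}"
  assumes w: "norm w > 1" and "n \<ge> 1"
  shows "hypercyclic (pow_dom (A_dom w) (A_op w) n) (A_op w ^^ n)"
proof -
  have mono: "mono (\<lambda>k. norm (weight w k))"
    by (rule monoI) (rule weight_mono[OF w])
  have pos: "0 < norm (weight w k)" for k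
    using weight_nonzero[OF w] by simp
  obtain a :: "nat \<Rightarrow> 'a"
    where lim: "\<And>m. (\<lambda>k. norm (a (k + m)) / norm (weight w k)) \<longlonglongrightarrow> 0"
      and univ: "\<And>b T \<epsilon>. \<epsilon> > 0 \<Longrightarrow> \<exists>m. (\<forall>k<T. norm (a (k + n * m) - b k) < \<epsilon>)
           \<and> (\<forall>k\<ge>T. norm (a (k + n * m)) / norm (weight w k) < \<epsilon>)"
    using universal_sequence[OF weight_at_top[OF w] mono pos assms(2)] by blast
  have lim': "(\<lambda>k. a (k + m) / weight w k) \<longlonglongrightarrow> 0" for m
    by (rule tendsto_norm_zero_cancel) (simp add: norm_divide lim)
  obtain x where x: "shift_coord w x = a"
    using ex_shift_coord[OF w, of a] lim'[of 0, unfolded add_0_right] by blast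
  have dom: "x \<in> pow_dom (A_dom w) (A_op w) m" for m
    by (simp add: pow_dom_iff[OF w] x lim')
  have "x \<noteq> 0"
  proof
    assume "x = 0"
    then have "a k = 0" for k
      using x by (auto simp: shift_coord_zero)
    then show False
      using univ[of 1 1 "\<lambda>_. 1"] by auto
  qed
  moreover have "x \<in> C_infinity (pow_dom (A_dom w) (A_op w) n) (A_op w ^^ n)"
    by (simp add: C_infinity_def pow_dom_pow_dom[OF w] dom)
  moreover have "y \<in> closure (range (\<lambda>m. ((A_op w ^^ n) ^^ m) x))" for y
    unfolding closure_approachable
  proof (intro allI impI)
    fix \<epsilon> :: real assume "\<epsilon> > 0"
    define \<delta> where "\<delta> = \<epsilon> / 5"
    have "\<delta> > 0"
      using \<open>\<epsilon> > 0\<close> by (simp add: \<delta>_def)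
    let ?b = "shift_coord w y"
    obtain T where T: "\<And>k. k \<ge> T \<Longrightarrow> norm (?b k / weight w k) < \<delta>"
      using LIMSEQ_D[OF shift_coord_tendsto[OF w] \<open>\<delta> > 0\<close>, of y] by auto
    obtain m where m: "\<And>k. k < T \<Longrightarrow> norm (a (k + n * m) - ?b k) < \<delta>"
        "\<And>k. k \<ge> T \<Longrightarrow> norm (a (k + n * m)) / norm (weight w k) < \<delta>"
      using univ[OF \<open>\<delta> > 0\<close>, of T ?b] by blast
    let ?z = "(A_op w ^^ (n * m)) x"
    have "norm (?z - y) \<le> 2 * (2 * \<delta>)"
    proof (rule norm_le_shift_coord[OF w])
      fix k
      have eq: "shift_coord w (?z - y) k = a (k + n * m) - ?b k"
        by (simp add: shift_coord_minus shift_coord_funpow[OF w dom] x)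
      show "norm (shift_coord w (?z - y) k / weight w k) \<le> 2 * \<delta>"
      proof (cases "k < T")
        case True
        have "norm (a (k + n * m) - ?b k) / norm (weight w k) \<le> norm (a (k + n * m) - ?b k) / 1"
          using weight_ge_1[OF w, of k] by (intro divide_left_mono) auto
        then show ?thesis
          using m(1)[OF True] \<open>\<delta> > 0\<close> by (simp add: eq norm_divide)
      next
        case False
        then show ?thesis
          using T[of k] m(2)[of k]
            norm_triangle_ineq4[of "a (k + n * m) / weight w k" "?b k / weight w k"]
          by (simp add: eq diff_divide_distrib norm_divide)
      qed
    qed
    moreover have "2 * (2 * \<delta>) < \<epsilon>"
      using \<open>\<epsilon> > 0\<close> by (simp add: \<delta>_def)
    ultimately show "\<exists>z\<in>range (\<lambda>m. ((A_op w ^^ n) ^^ m) x). dist z y < \<epsilon>"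
      by (intro bexI[of _ ?z]) (auto simp: dist_norm funpow_mult)
  qed
  ultimately show ?thesis
    unfolding hypercyclic_def hypercyclic_vector_def by blast
qed


section \<open>Chaos and the spectrum\<close>

theorem theorem5p2:
  fixes w :: "'a::{real_normed_field, euclidean_space}"
  assumes "norm w > 1"
  shows "linear_operator scaleF (A_dom w) (A_op w)
    \<and> unbounded_operator (A_dom w) (A_op w)
    \<and> closed_operator (A_dom w) (A_op w)
    \<and> chaotic (A_dom w) (A_op w)
    \<and> (\<forall>n\<ge>1.
          pow_dom (A_dom w) (A_op w) n =
            {x. (\<lambda>k. (\<Prod>j=k..k+n-1. w ^ j) * (coord x (k + n) - limit x)) \<longlonglongrightarrow> 0}
        \<and> (\<forall>x \<in> pow_dom (A_dom w) (A_op w) n. \<forall>k\<ge>1.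
              coord ((A_op w ^^ n) x) k =
                (\<Prod>j=k..k+n-1. w ^ j) * (coord x (k + n) - limit x)
                + (\<Prod>j=0..n-1. w ^ j) * (coord x n - limit x))
        \<and> linear_operator scaleF (pow_dom (A_dom w) (A_op w) n) (A_op w ^^ n)
        \<and> unbounded_operator (pow_dom (A_dom w) (A_op w) n) (A_op w ^^ n)
        \<and> closed_operator (pow_dom (A_dom w) (A_op w) n) (A_op w ^^ n)
        \<and> chaotic (pow_dom (A_dom w) (A_op w) n) (A_op w ^^ n))
    \<and> (\<forall>c::'a. eigenvalue scaleF (A_dom w) (A_op w) c
        \<and> vector_space.dim scaleF (eigenspace scaleF (A_dom w) (A_op w) c) = 1)"
proof -
  let ?D = "\<lambda>n. pow_dom (A_dom w) (A_op w) n" and ?A = "\<lambda>n. A_op w ^^ n"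
  have dom: "?D n = {x. (\<lambda>k. (\<Prod>j=k..k+n-1. w ^ j) * (coord x (k + n) - limit x)) \<longlonglongrightarrow> 0}"
    if "n \<ge> 1" for n
    by (simp only: set_eq_iff pow_dom_iff[OF assms] weight_ratio[OF assms that] mem_Collect_eq simp_thms)
  have chaos: "chaotic (?D n) (?A n)" if "n \<ge> 1" for n
    unfolding chaotic_def
    using hypercyclic_funpow[OF assms that] periodic_points_dense[OF assms that] by (rule conjI)
  have one: "?D 1 = A_dom w" "?A 1 = A_op w"
    by simp_all
  show ?thesis
    by (intro conjI allI impI ballI dom coord_funpow[OF assms] chaos linear_operator_funpow[OF assms]
        unbounded_operator_funpow[OF assms] closed_operator_funpow[OF assms]
        eigenvalue_A_op[OF assms] dim_eigenspace_A_op[OF assms]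
        linear_operator_funpow[OF assms, of 1, unfolded one]
        unbounded_operator_funpow[OF assms, of 1, unfolded one, OF order_refl]
        closed_operator_funpow[OF assms, of 1, unfolded one]
        chaos[of 1, unfolded one, OF order_refl])
qed

end
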